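(* Let $Q=\{11,13,15,17,19,21,22\}$. If $q\in Q$ and $k,a,b$ are integers with $k\ge 1$ and $0\le a,b<k$, then $$\operatorname{gp}(C_{11k+a}\boxtimes C_{qk+b})=11.$$ In particular, $\operatorname{gp}(C_s\boxtimes C_s)=11$ for every integer $s\ge 121$.
   Context: All graphs are finite, simple and connected. $d_G(u,v)$ is the usual shortest-path distance in $G$. A set $S\subseteq V(G)$ is a general position set of $G$ if no vertex of $S$ lies on a shortest path between two other vertices of $S$; equivalently, $d_G(u,v)\ne d_G(u,w)+d_G(w,v)$ for all pairwise distinct $u,v,w\in S$. The general position number $\operatorname{gp}(G)$ is the maximum cardinality of a general position set of $G$. The strong product $G\boxtimes H$ has vertex set $V(G)\times V(H)$; distinct vertices $(u_x,u_y)$ and $(v_x,v_y)$ are adjacent if and only if ($u_x=v_x$ and $u_yv_y\in E(H)$), or ($u_y=v_y$ and $u_xv_x\in E(G)$), or ($u_xv_x\in E(G)$ and $u_yv_y\in E(H)$). $C_n$ is the cycle on $n$ vertices. *)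

theory Defs
  imports Graph_Theory.Graph_Theory
begin

text \<open>
  A finite simple graph is a \<^locale>\<open>pair_graph\<close>: each edge is present as its two arcs.
\<close>

definition cycle_graph :: "nat \<Rightarrow> nat pair_pre_digraph" where
  "cycle_graph n =
    \<lparr> pverts = {..<n},
      parcs = {(i, j). i < n \<and> j < n \<and> (j = (i + 1) mod n \<or> i = (j + 1) mod n)} \<rparr>"

definition strong_product ::
    "'a pair_pre_digraph \<Rightarrow> 'b pair_pre_digraph \<Rightarrow> ('a \<times> 'b) pair_pre_digraph"
    (infixr \<open>\<boxtimes>\<close> 80) where
  "G \<boxtimes> H =
    \<lparr> pverts = pverts G \<times> pverts H,
      parcs = {((ux, uy), (vx, vy)).
        (ux, uy) \<in> pverts G \<times> pverts H \<and> (vx, vy) \<in> pverts G \<times> pverts H \<and>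
        (ux, uy) \<noteq> (vx, vy) \<and>
        (ux = vx \<and> (uy, vy) \<in> parcs H \<or>
         uy = vy \<and> (ux, vx) \<in> parcs G \<or>
         (ux, vx) \<in> parcs G \<and> (uy, vy) \<in> parcs H)} \<rparr>"

text \<open>Every edge has weight 1, so the least cost of a walk is the length of a shortest path.\<close>

definition graph_dist :: "'a pair_pre_digraph \<Rightarrow> 'a \<Rightarrow> 'a \<Rightarrow> ereal" where
  "graph_dist G u v = wf_digraph.\<mu> (with_proj G) (\<lambda>_. 1) u v"

definition general_position_set :: "'a pair_pre_digraph \<Rightarrow> 'a set \<Rightarrow> bool" where
  "general_position_set G S \<longleftrightarrow>
    S \<subseteq> pverts G \<and>
    (\<forall>u\<in>S. \<forall>v\<in>S. \<forall>w\<in>S. u \<noteq> v \<and> u \<noteq> w \<and> v \<noteq> w \<longrightarrow>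
      graph_dist G u v \<noteq> graph_dist G u w + graph_dist G w v)"

definition gp_number :: "'a pair_pre_digraph \<Rightarrow> nat" where
  "gp_number G = Max (card ` {S. general_position_set G S})"

lemma pair_graph_cycle_graph:
  assumes "n \<ge> 3"
  shows "pair_graph (cycle_graph n)"
proof -
  have "finite {(i, j). i < n \<and> j < n \<and> (j = (i + 1) mod n \<or> i = (j + 1) mod n)}"
    by (rule finite_subset[of _ "{..<n} \<times> {..<n}"]) auto
  moreover have "(i + 1) mod n \<noteq> i" for i
  proof (cases "i < n")
    case True
    with assms show ?thesis by (cases "i + 1 = n") auto
  next
    case False
    with assms show ?thesis
      by (metis mod_less_divisor less_le_trans zero_less_numeral)
  qed
  ultimately show ?thesis
    by unfold_locales
      (use assms in \<open>auto simp: cycle_graph_def symmetric_def intro!: symI, (metis+)?\<close>)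
qed

lemma pair_graph_strong_product:
  assumes "pair_graph G" "pair_graph H"
  shows "pair_graph (G \<boxtimes> H)"
proof -
  interpret G: pair_graph G by fact
  interpret H: pair_graph H by fact
  have sub: "parcs (G \<boxtimes> H) \<subseteq> (pverts G \<times> pverts H) \<times> (pverts G \<times> pverts H)"
    by (auto simp: strong_product_def)
  have fin: "finite (pverts G \<times> pverts H)"
    using G.pair_finite_verts H.pair_finite_verts by blast
  have "finite (parcs (G \<boxtimes> H))"
    using sub fin by (meson finite_SigmaI finite_subset)
  moreover have "symmetric (with_proj (G \<boxtimes> H))"
    using G.sym_arcs H.sym_arcs
    by (auto simp: symmetric_def strong_product_def intro!: symI dest: symD)
  ultimately show ?thesis
    using fin by unfold_locales (auto simp: strong_product_def)
qed

end

theory Submission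
  imports Defs
begin

text \<open>
  The distance in \<open>C\<^sub>m \<boxtimes> C\<^sub>n\<close> is the larger of the two cyclic distances of the coordinates, so the
  graph is a discrete torus with the maximum metric. Call two points horizontal if their distance
  is attained in the first coordinate, and vertical otherwise. If \<open>u\<close>, \<open>w\<close> and \<open>w\<close>, \<open>v\<close> are horizontal
  pairs and one goes forwards from \<open>u\<close> to \<open>w\<close> to \<open>v\<close> through at most half of \<open>C\<^sub>m\<close>, then the triangle
  inequality in the second coordinate makes \<open>u\<close>, \<open>v\<close> horizontal as well, and \<open>w\<close> is between them.

  Upper bound. In a general position set every two consecutive forward horizontal steps therefore
  cover more than \<open>m / 2\<close>. For a point \<open>w\<close> let \<open>p w\<close> and \<open>q w\<close> be the shortest horizontal steps into \<open>w\<close>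
  and out of \<open>w\<close>, so that \<open>p w + q w > m / 2\<close>. The arcs of length \<open>p w\<close> that end at \<open>w\<close> are disjoint for
  horizontal pairs, and so are the arcs of length \<open>q w\<close> that start at \<open>w\<close>. With \<open>N\<close> points, one of the
  two families has total length more than \<open>m N / 4\<close>, hence covers some position of \<open>C\<^sub>m\<close> more than
  \<open>N / 4\<close> times, and the points whose arcs contain it are pairwise vertical
  (\<open>large_independent_set_on_circle\<close>). If \<open>N \<ge> 12\<close> this gives four pairwise vertical points; but among
  four points of the cycle \<open>C\<^sub>n\<close> some one is between two others
  (\<open>betweenness_among_four_on_cycle\<close>). So \<open>N \<le> 11\<close>, for all \<open>m, n \<ge> 3\<close>.

  Lower bound. Multiplying all coordinates by \<open>k\<close> embeds \<open>C\<^sub>r \<boxtimes> C\<^sub>s\<close> into \<open>C\<^bsub>rk+a\<^esub> \<boxtimes> C\<^bsub>sk+b\<^esub>\<close>, and for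
  \<open>a, b < k\<close> the old distance is the new one divided by \<open>k\<close> and rounded down. As rounding down is
  superadditive, betweenness in the image implies betweenness in the original, and general position
  survives (\<open>torus_general_position_scale\<close>). It remains to give eleven points for \<open>k = 1\<close>: the
  multiples of \<open>(1, 4 q / 11)\<close>, rounded down.
\<close>

section \<open>Distances in strong products of cycles\<close>

text \<open>
  A local certificate that \<open>f\<close> measures distances to \<open>v\<close>: no arc lowers \<open>f\<close> by more than 1, and away
  from \<open>v\<close> some arc does lower it by 1. Such certificates combine easily over products.
\<close>
definition distance_to :: "'a pair_pre_digraph \<Rightarrow> 'a \<Rightarrow> ('a \<Rightarrow> nat) \<Rightarrow> bool" where
  "distance_to G v f \<longleftrightarrow>
    f v = 0 \<and>
    (\<forall>(x, y) \<in> parcs G. f x \<le> Suc (f y)) \<and>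
    (\<forall>x \<in> pverts G. x \<noteq> v \<longrightarrow> (\<exists>y. (x, y) \<in> parcs G \<and> f x = Suc (f y)))"

lemma graph_dist_eq:
  assumes "pair_wf_digraph G" "distance_to G v f" "u \<in> pverts G"
  shows "graph_dist G u v = ereal (real (f u))"
proof -
  interpret pair_wf_digraph G by fact
  have f0: "f v = 0" and fle: "\<And>x y. (x, y) \<in> parcs G \<Longrightarrow> f x \<le> Suc (f y)"
    and fex: "\<And>x. x \<in> pverts G \<Longrightarrow> x \<noteq> v \<Longrightarrow> \<exists>y. (x, y) \<in> parcs G \<and> f x = Suc (f y)"
    using assms(2) by (auto simp: distance_to_def)
  \<comment> \<open>A walk to \<open>v\<close> has to bring \<open>f\<close> down to 0, and each arc contributes at most 1.\<close>
  have lower: "real (f x) \<le> awalk_cost (\<lambda>_. 1) p" if "awalk x p v" for x p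
    using that
  proof (induction p arbitrary: x)
    case Nil
    then show ?case using f0 by (simp add: awalk_Nil_iff)
  next
    case (Cons e p)
    obtain y where e: "e = (x, y)" "(x, y) \<in> parcs G" "awalk y p v"
      using Cons.prems by (cases e) (auto simp: awalk_Cons_iff)
    show ?case using Cons.IH[OF e(3)] fle[OF e(2)] by simp
  qed
  \<comment> \<open>Descending greedily along \<open>f\<close> is a walk that meets this bound.\<close>
  have upper: "\<exists>p. awalk x p v \<and> awalk_cost (\<lambda>_. 1) p = real (f x)"
    if "x \<in> pverts G" for x
    using that
  proof (induction "f x" arbitrary: x rule: less_induct)
    case less
    show ?case
    proof (cases "x = v")
      case True
      then show ?thesis using f0 less.prems by (intro exI[of _ "[]"]) (simp add: awalk_Nil_iff)
    next
      case False
      then obtain y where y: "(x, y) \<in> parcs G" "f x = Suc (f y)"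
        using fex less.prems by blast
      then obtain p where "awalk y p v" "awalk_cost (\<lambda>_. 1) p = real (f y)"
        using less.hyps[of y] in_arcsD2[OF y(1)] by auto
      then show ?thesis using y
        by (intro exI[of _ "(x, y) # p"]) (simp add: awalk_Cons_iff)
    qed
  qed
  obtain p where "awalk u p v" "awalk_cost (\<lambda>_. 1) p = real (f u)"
    using upper assms(3) by blast
  then show ?thesis
    unfolding graph_dist_def \<mu>_def
    by (intro antisym INF_greatest INF_lower2[of p]) (auto intro: lower)
qed

lemma distance_to_strong_product:
  assumes f: "distance_to G v f" and g: "distance_to H w g"
    and "pair_wf_digraph G" "pair_wf_digraph H" "v \<in> pverts G" "w \<in> pverts H"
  shows "distance_to (G \<boxtimes> H) (v, w) (\<lambda>(x, y). max (f x) (g y))"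
proof -
  interpret G: pair_wf_digraph G by fact
  interpret H: pair_wf_digraph H by fact
  have verts: "pverts (G \<boxtimes> H) = pverts G \<times> pverts H"
    by (simp add: strong_product_def)
  have "\<exists>x' y'. ((x, y), (x', y')) \<in> parcs (G \<boxtimes> H) \<and>
      max (f x) (g y) = Suc (max (f x') (g y'))"
    if xy: "x \<in> pverts G" "y \<in> pverts H" "(x, y) \<noteq> (v, w)" for x y
  proof -
    \<comment> \<open>Each coordinate that is not yet at its target steps towards it, at the same time.\<close>
    obtain x' where x': "x = v \<and> x' = v \<and> f x = 0 \<and> f x' = 0 \<or> (x, x') \<in> parcs G \<and> f x = Suc (f x')"
      using f xy unfolding distance_to_def by metis
    obtain y' where y': "y = w \<and> y' = w \<and> g y = 0 \<and> g y' = 0 \<or> (y, y') \<in> parcs H \<and> g y = Suc (g y')"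
      using g xy unfolding distance_to_def by metis
    have "((x, y), (x', y')) \<in> parcs (G \<boxtimes> H) \<and> max (f x) (g y) = Suc (max (f x') (g y'))"
      using x' y' xy G.in_arcsD2 H.in_arcsD2
      by (auto simp: strong_product_def)
    then show ?thesis by blast
  qed
  moreover have "f v = 0" "g w = 0"
    using f g by (auto simp: distance_to_def)
  moreover have "max (f x) (g y) \<le> Suc (max (f x') (g y'))"
    if "((x, y), (x', y')) \<in> parcs (G \<boxtimes> H)" for x y x' y'
  proof -
    have "f x \<le> Suc (f x')" "g y \<le> Suc (g y')"
      using that f g by (auto simp: strong_product_def distance_to_def)
    then show ?thesis by (auto simp: max_def)
  qed
  ultimately show ?thesis
    unfolding distance_to_def by (auto simp: verts)
qed

text \<open>
  For positions \<open>i, j < n\<close> this is \<open>(j - i) mod n\<close>, the length of the arc from \<open>i\<close> up to \<open>j\<close>. The case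
  distinction keeps statements about it within linear arithmetic.
\<close>
definition fwd :: "nat \<Rightarrow> nat \<Rightarrow> nat \<Rightarrow> nat" where
  "fwd n i j = (if i \<le> j then j - i else n + j - i)"

definition cyc_dist :: "nat \<Rightarrow> nat \<Rightarrow> nat \<Rightarrow> nat" where
  "cyc_dist n i j = min (fwd n i j) (fwd n j i)"

lemma cyc_dist_commute: "cyc_dist n i j = cyc_dist n j i"
  by (simp add: cyc_dist_def min.commute)

lemma fwd_triangle:
  assumes "i < n" "j < n" "l < n"
  shows "fwd n i j \<le> fwd n i l + fwd n l j"
  using assms by (auto simp: fwd_def)

lemma cyc_dist_triangle:
  assumes "i < n" "j < n" "l < n"
  shows "cyc_dist n i j \<le> cyc_dist n i l + cyc_dist n l j"
proof -
  have "fwd n i j \<le> fwd n i l + fwd n l j" "fwd n j i \<le> fwd n j l + fwd n l i"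
    using assms by (auto intro: fwd_triangle)
  moreover have "fwd n i j \<le> fwd n i l \<or> fwd n j i \<le> fwd n j l"
    "fwd n i j \<le> fwd n l j \<or> fwd n j i \<le> fwd n l i"
    using assms by (auto simp: fwd_def)
  ultimately show ?thesis
    unfolding cyc_dist_def by linarith
qed

lemma cyc_dist_eq_0_iff:
  assumes "i < n" "j < n"
  shows "cyc_dist n i j = 0 \<longleftrightarrow> i = j"
  using assms by (auto simp: cyc_dist_def fwd_def min_def)

lemma cyc_dist_of_fwd_le_half:
  assumes "i < n" "j < n" "2 * fwd n i j \<le> n"
  shows "cyc_dist n i j = fwd n i j"
  using assms by (auto simp: cyc_dist_def fwd_def)

lemma fwd_add:
  assumes "i < n" "j < n" "l < n" "fwd n i l + fwd n l j < n"
  shows "fwd n i j = fwd n i l + fwd n l j"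
  using assms by (auto simp: fwd_def split: if_splits)

lemma fwd_split:
  assumes "i < n" "j < n" "l < n" "fwd n i l \<le> fwd n i j"
  shows "fwd n i j = fwd n i l + fwd n l j"
  using assms by (auto simp: fwd_def split: if_splits)

lemma fwd_split':
  assumes "i < n" "j < n" "l < n" "fwd n l j \<le> fwd n i j"
  shows "fwd n i j = fwd n i l + fwd n l j"
  using assms by (auto simp: fwd_def split: if_splits)

text \<open>An arc of at most half the cycle is a shortest path, so its inner points are between its ends.\<close>
lemma cyc_dist_add:
  assumes "i < n" "j < n" "l < n" "2 * (fwd n i l + fwd n l j) \<le> n"
  shows "cyc_dist n i j = cyc_dist n i l + cyc_dist n l j"
proof -
  have "fwd n i j = fwd n i l + fwd n l j"
    using assms by (intro fwd_add) auto
  then show ?thesis using assms by (simp add: cyc_dist_of_fwd_le_half)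
qed
lemma distance_to_cycle_graph:
  assumes "v < n" "2 \<le> n"
  shows "distance_to (cycle_graph n) v (\<lambda>x. cyc_dist n x v)"
proof -
  have arcs: "parcs (cycle_graph n) = {(i, j). i < n \<and> j < n \<and>
      (j = (if Suc i = n then 0 else Suc i) \<or> i = (if Suc j = n then 0 else Suc j))}"
    unfolding cycle_graph_def by auto
  have "\<exists>y. (x, y) \<in> parcs (cycle_graph n) \<and> cyc_dist n x v = Suc (cyc_dist n y v)"
    if x: "x < n" "x \<noteq> v" for x
  proof (cases "fwd n x v \<le> fwd n v x")
    case True
    define y where "y = (if Suc x = n then 0 else Suc x)"
    have "fwd n x v = Suc (fwd n y v)" "fwd n y v \<le> fwd n v y"
      using x True assms by (auto simp: y_def fwd_def split: if_splits)
    then have "cyc_dist n x v = Suc (cyc_dist n y v)"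
      using True by (simp add: cyc_dist_def)
    moreover have "(x, y) \<in> parcs (cycle_graph n)"
      using x assms by (auto simp: arcs y_def)
    ultimately show ?thesis by blast
  next
    case False
    define y where "y = (if x = 0 then n - 1 else x - 1)"
    have "fwd n v x = Suc (fwd n v y)" "fwd n v y \<le> fwd n y v"
      using x False assms by (auto simp: y_def fwd_def split: if_splits)
    then have "cyc_dist n x v = Suc (cyc_dist n y v)"
      using False by (simp add: cyc_dist_def)
    moreover have "(x, y) \<in> parcs (cycle_graph n)"
      using x assms by (auto simp: arcs y_def)
    ultimately show ?thesis by blast
  qed
  moreover have "cyc_dist n x v \<le> Suc (cyc_dist n y v)"
    if "(x, y) \<in> parcs (cycle_graph n)" for x y
  proof -
    have xy: "x < n" "y < n" using that by (auto simp: arcs)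
    have "fwd n x y \<le> 1 \<or> fwd n y x \<le> 1"
      using that assms by (auto simp: arcs fwd_def split: if_splits)
    then have "cyc_dist n x y \<le> 1" by (auto simp: cyc_dist_def)
    then show ?thesis using cyc_dist_triangle[of x n v y] xy assms by simp
  qed
  moreover have "cyc_dist n v v = 0" by (simp add: cyc_dist_def fwd_def)
  ultimately show ?thesis
    unfolding distance_to_def by (auto simp: cycle_graph_def)
qed

definition torus_dist :: "nat \<Rightarrow> nat \<Rightarrow> nat \<times> nat \<Rightarrow> nat \<times> nat \<Rightarrow> nat" where
  "torus_dist m n u v = max (cyc_dist m (fst u) (fst v)) (cyc_dist n (snd u) (snd v))"

lemma graph_dist_cycle_product:
  assumes "m \<ge> 3" "n \<ge> 3" "u \<in> {..<m} \<times> {..<n}" "v \<in> {..<m} \<times> {..<n}"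
  shows "graph_dist (cycle_graph m \<boxtimes> cycle_graph n) u v = ereal (real (torus_dist m n u v))"
proof -
  interpret C: pair_graph "cycle_graph m" using assms(1) by (rule pair_graph_cycle_graph)
  interpret D: pair_graph "cycle_graph n" using assms(2) by (rule pair_graph_cycle_graph)
  interpret P: pair_graph "cycle_graph m \<boxtimes> cycle_graph n"
    by (rule pair_graph_strong_product) unfold_locales
  have "distance_to (cycle_graph m \<boxtimes> cycle_graph n) (fst v, snd v)
      (\<lambda>(x, y). max (cyc_dist m x (fst v)) (cyc_dist n y (snd v)))"
    using assms
    by (intro distance_to_strong_product distance_to_cycle_graph
        C.pair_wf_digraph_axioms D.pair_wf_digraph_axioms)
       (auto simp: cycle_graph_def)
  from graph_dist_eq[OF P.pair_wf_digraph_axioms this, of u] show ?thesis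
    using assms by (cases u, cases v) (simp add: torus_dist_def strong_product_def cycle_graph_def)
qed

definition torus_general_position :: "nat \<Rightarrow> nat \<Rightarrow> (nat \<times> nat) set \<Rightarrow> bool" where
  "torus_general_position m n S \<longleftrightarrow>
    S \<subseteq> {..<m} \<times> {..<n} \<and>
    (\<forall>u\<in>S. \<forall>v\<in>S. \<forall>w\<in>S. u \<noteq> v \<and> u \<noteq> w \<and> v \<noteq> w \<longrightarrow>
      torus_dist m n u v \<noteq> torus_dist m n u w + torus_dist m n w v)"

lemma general_position_set_cycle_product:
  assumes "m \<ge> 3" "n \<ge> 3"
  shows "general_position_set (cycle_graph m \<boxtimes> cycle_graph n) S \<longleftrightarrow>
    torus_general_position m n S"
proof -
  have verts: "pverts (cycle_graph m \<boxtimes> cycle_graph n) = {..<m} \<times> {..<n}"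
    by (simp add: strong_product_def cycle_graph_def)
  have "(graph_dist (cycle_graph m \<boxtimes> cycle_graph n) u v =
        graph_dist (cycle_graph m \<boxtimes> cycle_graph n) u w +
        graph_dist (cycle_graph m \<boxtimes> cycle_graph n) w v) \<longleftrightarrow>
      torus_dist m n u v = torus_dist m n u w + torus_dist m n w v"
    if "u \<in> {..<m} \<times> {..<n}" "v \<in> {..<m} \<times> {..<n}" "w \<in> {..<m} \<times> {..<n}" for u v w
    using that by (simp only: graph_dist_cycle_product[OF assms] plus_ereal.simps ereal.inject
        of_nat_add[symmetric] of_nat_eq_iff)
  then show ?thesis
    unfolding general_position_set_def torus_general_position_def verts
    by (meson subsetD)
qed

lemma torus_dist_triangle:
  assumes "u \<in> {..<m} \<times> {..<n}" "v \<in> {..<m} \<times> {..<n}" "w \<in> {..<m} \<times> {..<n}"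
  shows "torus_dist m n u v \<le> torus_dist m n u w + torus_dist m n w v"
proof -
  have "cyc_dist m (fst u) (fst v) \<le> cyc_dist m (fst u) (fst w) + cyc_dist m (fst w) (fst v)"
    "cyc_dist n (snd u) (snd v) \<le> cyc_dist n (snd u) (snd w) + cyc_dist n (snd w) (snd v)"
    using assms by (auto intro!: cyc_dist_triangle)
  then show ?thesis by (auto simp: torus_dist_def max_def)
qed

section \<open>The upper bound\<close>

lemma card_backward_arc:
  assumes "x < m" "p \<le> m"
  shows "card {z. z < m \<and> fwd m z x < p} = p"
proof -
  have "bij_betw (\<lambda>z. fwd m z x) {z. z < m \<and> fwd m z x < p} {..<p}"
    by (rule bij_betw_byWitness[where f' = "\<lambda>d. fwd m d x"])
       (use assms in \<open>auto simp: fwd_def split: if_splits\<close>)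
  then show ?thesis by (simp add: bij_betw_same_card)
qed

lemma card_forward_arc:
  assumes "x < m" "q \<le> m"
  shows "card {z. z < m \<and> fwd m x z < q} = q"
proof -
  have "bij_betw (\<lambda>z. fwd m x z) {z. z < m \<and> fwd m x z < q} {..<q}"
    by (rule bij_betw_byWitness[where f' = "\<lambda>d. if x + d < m then x + d else x + d - m"])
       (use assms in \<open>auto simp: fwd_def split: if_splits\<close>)
  then show ?thesis by (simp add: bij_betw_same_card)
qed

text \<open>Double counting: the cardinalities sum to the total covering multiplicity of the points below \<open>m\<close>.\<close>
lemma sum_card_le_if_cover_le:
  fixes A :: "'a \<Rightarrow> nat set"
  assumes "finite S" "\<And>w. w \<in> S \<Longrightarrow> A w \<subseteq> {..<m}"
    and "\<And>z. z < m \<Longrightarrow> c * card {w \<in> S. z \<in> A w} \<le> N"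
  shows "c * (\<Sum>w\<in>S. card (A w)) \<le> m * N"
proof -
  have "card (A w) = (\<Sum>z<m. if z \<in> A w then 1 else 0)" if "w \<in> S" for w
    using assms(2)[OF that] by (simp add: sum.If_cases Int_absorb1)
  then have "(\<Sum>w\<in>S. card (A w)) = (\<Sum>w\<in>S. \<Sum>z<m. if z \<in> A w then 1 else 0)"
    by simp
  also have "\<dots> = (\<Sum>z<m. card {w \<in> S. z \<in> A w})"
    using assms(1) by (subst sum.swap) (simp add: sum.If_cases Int_def)
  finally have "c * (\<Sum>w\<in>S. card (A w)) = (\<Sum>z<m. c * card {w \<in> S. z \<in> A w})"
    by (simp add: sum_distrib_left)
  also have "\<dots> \<le> (\<Sum>z<m. N)"
    by (rule sum_mono) (use assms(3) in auto)
  finally show ?thesis by simp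
qed

text \<open>
  The points \<open>X u\<close> lie on a cycle of length \<open>m\<close>, and \<open>R\<close> is a graph on \<open>S\<close> in which every two consecutive
  forward steps cover more than half of the cycle. Then one vertex's shortest step in and
  shortest step out also have total length more than \<open>m / 2\<close>. Averaging over the positions on the
  cycle, the arcs swept by all the shortest steps in, or those by all the shortest steps out, pile
  up more than \<open>card S / 4\<close> deep somewhere, and arcs that overlap belong to non-adjacent vertices.
\<close>
lemma large_independent_set_on_circle:
  fixes X :: "'a \<Rightarrow> nat"
  assumes fin: "finite S" and ne: "S \<noteq> {}" and X: "\<And>u. u \<in> S \<Longrightarrow> X u < m"
    and sym: "\<And>u v. R u v \<Longrightarrow> R v u"
    and inj: "\<And>u v. u \<in> S \<Longrightarrow> v \<in> S \<Longrightarrow> R u v \<Longrightarrow> X u \<noteq> X v"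
    and two_steps: "\<And>u w v. u \<in> S \<Longrightarrow> w \<in> S \<Longrightarrow> v \<in> S \<Longrightarrow> R u w \<Longrightarrow> R w v \<Longrightarrow>
      m < 2 * (fwd m (X u) (X w) + fwd m (X w) (X v))"
    and m: "2 \<le> m"
  shows "\<exists>T\<subseteq>S. card S < 4 * card T \<and> (\<forall>u\<in>T. \<forall>v\<in>T. \<not> R u v)"
proof (rule ccontr)
  assume "\<not> ?thesis"
  then have small: "4 * card T \<le> card S"
    if "T \<subseteq> S" "\<And>u v. u \<in> T \<Longrightarrow> v \<in> T \<Longrightarrow> \<not> R u v" for T
    using that by (meson not_le)
  \<comment> \<open>The value \<open>m div 2\<close> is a default for vertices without neighbours. Capping by it is harmless:
    together with any positive length it still exceeds \<open>m / 2\<close>.\<close>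
  define p where "p w = Min (insert (m div 2) ((\<lambda>u. fwd m (X u) (X w)) ` {u \<in> S. R u w}))" for w
  define q where "q w = Min (insert (m div 2) ((\<lambda>v. fwd m (X w) (X v)) ` {v \<in> S. R w v}))" for w
  have p_le: "p w \<le> fwd m (X u) (X w)" if "u \<in> S" "R u w" for u w
    unfolding p_def using that fin by (intro Min_le) auto
  have q_le: "q w \<le> fwd m (X w) (X v)" if "v \<in> S" "R w v" for v w
    unfolding q_def using that fin by (intro Min_le) auto
  have half: "p w \<le> m div 2" "q w \<le> m div 2" for w
    unfolding p_def q_def using fin by (auto intro: Min_le)
  have p_cases: "p w = m div 2 \<or> (\<exists>u\<in>S. R u w \<and> p w = fwd m (X u) (X w))" for w
    using Min_in[of "insert (m div 2) ((\<lambda>u. fwd m (X u) (X w)) ` {u \<in> S. R u w})"] fin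
    unfolding p_def[symmetric] by auto
  have q_cases: "q w = m div 2 \<or> (\<exists>v\<in>S. R w v \<and> q w = fwd m (X w) (X v))" for w
    using Min_in[of "insert (m div 2) ((\<lambda>v. fwd m (X w) (X v)) ` {v \<in> S. R w v})"] fin
    unfolding q_def[symmetric] by auto
  have pos: "0 < fwd m (X u) (X v)" if "u \<in> S" "v \<in> S" "R u v" for u v
    using inj[OF that] X[OF that(1)] by (auto simp: fwd_def)
  have long: "m < 2 * (p w + q w)" if w: "w \<in> S" for w
  proof -
    have "0 < p w" using p_cases[of w] pos w m by fastforce
    moreover have "0 < q w" using q_cases[of w] pos w m by fastforce
    ultimately show ?thesis
      using p_cases[of w] q_cases[of w] two_steps[OF _ w] by fastforce
  qed
  \<comment> \<open>If a position lies in the backward arcs of \<open>u\<close> and \<open>v\<close>, with \<open>u\<close> met first, then the step from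
    \<open>u\<close> to \<open>v\<close> fits into the arc of \<open>v\<close> and is shorter than \<open>p v\<close>.\<close>
  have sum_p: "4 * (\<Sum>w\<in>S. card {z. z < m \<and> fwd m z (X w) < p w}) \<le> m * card S"
  proof (rule sum_card_le_if_cover_le[OF fin])
    fix z assume "z < m"
    show "4 * card {w \<in> S. z \<in> {z. z < m \<and> fwd m z (X w) < p w}} \<le> card S"
    proof (rule small)
      fix u v assume "u \<in> {w \<in> S. z \<in> {z. z < m \<and> fwd m z (X w) < p w}}"
        "v \<in> {w \<in> S. z \<in> {z. z < m \<and> fwd m z (X w) < p w}}"
      then have uv: "u \<in> S" "v \<in> S" "fwd m z (X u) < p u" "fwd m z (X v) < p v" by auto
      show "\<not> R u v"
      proof
        assume "R u v"
        then have "p v \<le> fwd m (X u) (X v)" "p u \<le> fwd m (X v) (X u)" "X u \<noteq> X v"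
          using p_le uv sym inj by auto
        moreover have "fwd m z (X v) = fwd m z (X u) + fwd m (X u) (X v) \<or>
            fwd m z (X u) = fwd m z (X v) + fwd m (X v) (X u)"
          using fwd_split[of z m "X v" "X u"] fwd_split[of z m "X u" "X v"] X uv \<open>z < m\<close>
          by (metis nat_le_linear)
        ultimately show False using uv(3,4) by linarith
      qed
    qed auto
  qed auto
  \<comment> \<open>The mirror image of the same argument, with forward arcs.\<close>
  have sum_q: "4 * (\<Sum>w\<in>S. card {z. z < m \<and> fwd m (X w) z < q w}) \<le> m * card S"
  proof (rule sum_card_le_if_cover_le[OF fin])
    fix z assume "z < m"
    show "4 * card {w \<in> S. z \<in> {z. z < m \<and> fwd m (X w) z < q w}} \<le> card S"
    proof (rule small)
      fix u v assume "u \<in> {w \<in> S. z \<in> {z. z < m \<and> fwd m (X w) z < q w}}"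
        "v \<in> {w \<in> S. z \<in> {z. z < m \<and> fwd m (X w) z < q w}}"
      then have uv: "u \<in> S" "v \<in> S" "fwd m (X u) z < q u" "fwd m (X v) z < q v" by auto
      show "\<not> R u v"
      proof
        assume "R u v"
        then have "q u \<le> fwd m (X u) (X v)" "q v \<le> fwd m (X v) (X u)" "X u \<noteq> X v"
          using q_le uv sym inj by auto
        moreover have "fwd m (X v) z = fwd m (X v) (X u) + fwd m (X u) z \<or>
            fwd m (X u) z = fwd m (X u) (X v) + fwd m (X v) z"
          using fwd_split'[of "X v" m z "X u"] fwd_split'[of "X u" m z "X v"] X uv \<open>z < m\<close>
          by (metis nat_le_linear)
        ultimately show False using uv(3,4) by linarith
      qed
    qed auto
  qed auto
  have le_m: "p w \<le> m" "q w \<le> m" for w using half[of w] by auto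
  have "4 * (\<Sum>w\<in>S. p w) \<le> m * card S" "4 * (\<Sum>w\<in>S. q w) \<le> m * card S"
    using sum_p sum_q X le_m by (simp_all add: card_backward_arc card_forward_arc)
  moreover have "(\<Sum>w\<in>S. m) < (\<Sum>w\<in>S. 2 * (p w + q w))"
    by (rule sum_strict_mono[OF fin ne]) (rule long)
  then have "m * card S < 2 * (\<Sum>w\<in>S. p w) + 2 * (\<Sum>w\<in>S. q w)"
    by (simp add: sum.distrib mult.commute[of m] flip: sum_distrib_left)
  ultimately show False by linarith
qed

text \<open>
  Cut the cycle at the first and the third of four points. One of the two arcs is at most half of
  the cycle, and each of them contains another of the four points.
\<close>
lemma betweenness_among_four_on_cycle:
  assumes "A \<subseteq> {..<n}" "4 \<le> card A"
  shows "\<exists>i\<in>A. \<exists>j\<in>A. \<exists>l\<in>A. i \<noteq> j \<and> i \<noteq> l \<and> j \<noteq> l \<and>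
    cyc_dist n i j = cyc_dist n i l + cyc_dist n l j"
proof -
  have fin: "finite A" using assms(1) finite_subset by blast
  define xs where "xs = sorted_list_of_set A"
  have len: "4 \<le> length xs" using assms(2) by (simp add: xs_def)
  have "sorted_wrt (<) xs" by (simp add: xs_def)
  then have "xs ! 0 < xs ! 1" "xs ! 1 < xs ! 2" "xs ! 2 < xs ! 3"
    using len by (auto simp: sorted_wrt_iff_nth_less)
  moreover have "xs ! i \<in> A" if "i < 4" for i
    using that len fin nth_mem[of i xs] by (simp add: xs_def)
  ultimately obtain a b c d where abcd: "a \<in> A" "b \<in> A" "c \<in> A" "d \<in> A" "a < b" "b < c" "c < d"
    by (metis one_less_numeral_iff numeral_less_iff semiring_norm(76,78,79,81) zero_less_numeral)
  have "d < n" using abcd assms(1) by auto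
  show ?thesis
  proof (cases "2 * (c - a) \<le> n")
    case True
    then have "cyc_dist n a c = cyc_dist n a b + cyc_dist n b c"
      using abcd \<open>d < n\<close> by (intro cyc_dist_add) (auto simp: fwd_def)
    then show ?thesis using abcd by (metis less_imp_neq less_trans)
  next
    case False
    then have "cyc_dist n c a = cyc_dist n c d + cyc_dist n d a"
      using abcd \<open>d < n\<close> by (intro cyc_dist_add) (auto simp: fwd_def)
    then show ?thesis using abcd by (metis less_imp_neq less_trans)
  qed
qed

text \<open>
  Horizontal pairs satisfy the hypothesis of \<open>large_independent_set_on_circle\<close>, and four pairwise
  vertical points inherit betweenness from their second coordinates.
\<close>
lemma card_torus_general_position_le:
  assumes S: "torus_general_position m n S" and "2 \<le> m"
  shows "card S \<le> 11"
proof (rule ccontr)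
  assume "\<not> ?thesis"
  then have card: "12 \<le> card S" by simp
  then have fin: "finite S" and "S \<noteq> {}" by (auto intro: card_ge_0_finite)
  have sub: "S \<subseteq> {..<m} \<times> {..<n}" using S by (simp add: torus_general_position_def)
  have gp: "torus_dist m n u v \<noteq> torus_dist m n u w + torus_dist m n w v"
    if "u \<in> S" "v \<in> S" "w \<in> S" "u \<noteq> v" "u \<noteq> w" "v \<noteq> w" for u v w
    using S that unfolding torus_general_position_def by blast
  \<comment> \<open>The horizontal pairs.\<close>
  define R where "R u v \<longleftrightarrow> u \<noteq> v \<and> cyc_dist n (snd u) (snd v) \<le> cyc_dist m (fst u) (fst v)"
    for u v :: "nat \<times> nat"
  have bnd: "fst u < m" "snd u < n" if "u \<in> S" for u using sub that by auto
  have R_fst: "fst u \<noteq> fst v" if "u \<in> S" "v \<in> S" "R u v" for u v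
  proof
    assume "fst u = fst v"
    then have "cyc_dist m (fst u) (fst v) = 0" by (simp add: cyc_dist_def fwd_def)
    then have "snd u = snd v"
      using that bnd cyc_dist_eq_0_iff[of "snd u" n "snd v"] by (simp add: R_def)
    then show False
      using \<open>fst u = fst v\<close> that by (simp add: R_def prod_eq_iff)
  qed
  have "m < 2 * (fwd m (fst u) (fst w) + fwd m (fst w) (fst v))"
    if uwv: "u \<in> S" "w \<in> S" "v \<in> S" and R: "R u w" "R w v" for u w v
  proof (rule ccontr)
    assume "\<not> ?thesis"
    then have add: "cyc_dist m (fst u) (fst v) = cyc_dist m (fst u) (fst w) + cyc_dist m (fst w) (fst v)"
      using uwv[THEN bnd(1)] by (intro cyc_dist_add) auto
    moreover have "cyc_dist m (fst u) (fst w) \<noteq> 0"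
      using R_fst[OF _ _ R(1)] uwv bnd by (simp add: cyc_dist_eq_0_iff)
    ultimately have ne: "fst u \<noteq> fst v"
      using uwv bnd cyc_dist_eq_0_iff[of "fst u" m "fst v"] by auto
    have "cyc_dist n (snd u) (snd v) \<le> cyc_dist n (snd u) (snd w) + cyc_dist n (snd w) (snd v)"
      using uwv bnd by (intro cyc_dist_triangle)
    then have "torus_dist m n u v = torus_dist m n u w + torus_dist m n w v"
      using R add by (auto simp: torus_dist_def R_def)
    then show False using gp[of u v w] uwv R ne by (auto simp: R_def)
  qed
  moreover have "R v u" if "R u v" for u v
    using that by (auto simp: R_def cyc_dist_commute)
  ultimately have "\<exists>T\<subseteq>S. card S < 4 * card T \<and> (\<forall>u\<in>T. \<forall>v\<in>T. \<not> R u v)"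
    by (intro large_independent_set_on_circle[where X = fst and m = m])
       (use fin \<open>S \<noteq> {}\<close> bnd R_fst assms(2) in simp_all)
  then obtain T where T: "T \<subseteq> S" "card S < 4 * card T" "\<And>u v. u \<in> T \<Longrightarrow> v \<in> T \<Longrightarrow> \<not> R u v"
    by blast
  have vertical: "cyc_dist m (fst u) (fst v) < cyc_dist n (snd u) (snd v)"
    if "u \<in> T" "v \<in> T" "u \<noteq> v" for u v
    using T(3) that by (fastforce simp: R_def)
  have "inj_on snd T"
  proof (rule inj_onI, rule ccontr)
    fix u v assume "u \<in> T" "v \<in> T" "snd u = snd v" "u \<noteq> v"
    then show False using vertical[of u v] by (simp add: cyc_dist_def fwd_def)
  qed
  then have "4 \<le> card (snd ` T)" using T(2) card by (simp add: card_image)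
  moreover have "snd ` T \<subseteq> {..<n}" using T(1) bnd by auto
  ultimately obtain u v w where uvw: "u \<in> T" "v \<in> T" "w \<in> T" "u \<noteq> v" "u \<noteq> w" "v \<noteq> w"
    and eq: "cyc_dist n (snd u) (snd v) = cyc_dist n (snd u) (snd w) + cyc_dist n (snd w) (snd v)"
    using betweenness_among_four_on_cycle[of "snd ` T" n] by auto
  have "torus_dist m n u v = torus_dist m n u w + torus_dist m n w v"
    using vertical[of u v] vertical[of u w] vertical[of w v] uvw eq
    by (simp add: torus_dist_def max_def)
  then show False using gp[of u v w] uvw T(1) by auto
qed

section \<open>Scaling a configuration\<close>

text \<open>
  An arc of the scaled cycle has \<open>k\<close> times its former length, plus \<open>a\<close> if it passes the seam at 0.
  Since \<open>a < k\<close>, division by \<open>k\<close> removes the surplus.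
\<close>
lemma fwd_scale_div:
  assumes "i < r" "j < r" "a < k"
  shows "fwd (r * k + a) (i * k) (j * k) div k = fwd r i j"
proof (cases "i \<le> j")
  case True
  then have "fwd (r * k + a) (i * k) (j * k) = (j - i) * k"
    by (simp add: fwd_def diff_mult_distrib)
  then show ?thesis using True assms by (simp add: fwd_def)
next
  case False
  have "i * k \<le> (r + j) * k" using assms by (intro mult_right_mono) auto
  then have "fwd (r * k + a) (i * k) (j * k) = (r + j - i) * k + a"
    using False assms by (simp add: fwd_def diff_mult_distrib add_mult_distrib)
  then show ?thesis using False assms by (simp add: fwd_def)
qed

lemma cyc_dist_scale_div:
  assumes "i < r" "j < r" "a < k"
  shows "cyc_dist (r * k + a) (i * k) (j * k) div k = cyc_dist r i j"
proof -
  have "mono (\<lambda>x :: nat. x div k)" by (simp add: monoI div_le_mono)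
  from min_of_mono[OF this, symmetric] show ?thesis
    using assms by (simp add: cyc_dist_def fwd_scale_div)
qed

lemma torus_dist_scale_div:
  assumes "u \<in> {..<r} \<times> {..<s}" "v \<in> {..<r} \<times> {..<s}" "a < k" "b < k"
  shows "torus_dist (r * k + a) (s * k + b)
      (map_prod (\<lambda>x. x * k) (\<lambda>y. y * k) u) (map_prod (\<lambda>x. x * k) (\<lambda>y. y * k) v) div k =
    torus_dist r s u v"
proof -
  have "mono (\<lambda>x :: nat. x div k)" by (simp add: monoI div_le_mono)
  from max_of_mono[OF this, symmetric] show ?thesis
    using assms by (auto simp: torus_dist_def cyc_dist_scale_div)
qed

lemma torus_general_position_scale:
  assumes S: "torus_general_position r s S" and a: "a < k" and b: "b < k"
  defines "h \<equiv> map_prod (\<lambda>x :: nat. x * k) (\<lambda>y :: nat. y * k)"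
  shows "torus_general_position (r * k + a) (s * k + b) (h ` S)" "card (h ` S) = card S"
proof -
  let ?D = "torus_dist (r * k + a) (s * k + b)"
  have k: "0 < k" using a by simp
  have sub: "S \<subseteq> {..<r} \<times> {..<s}" using S by (simp add: torus_general_position_def)
  have "inj h" using k by (auto simp: h_def inj_def)
  then show "card (h ` S) = card S" by (auto intro: card_image inj_on_subset)
  have less: "x * k < t * k + c" if "x < t" for x t c
    using k that by (simp add: trans_less_add1)
  have "?D (h u) (h v) \<noteq> ?D (h u) (h w) + ?D (h w) (h v)"
    if uvw: "u \<in> S" "v \<in> S" "w \<in> S" "u \<noteq> v" "u \<noteq> w" "v \<noteq> w" for u v w
  proof
    assume eq: "?D (h u) (h v) = ?D (h u) (h w) + ?D (h w) (h v)"
    have div: "?D (h x) (h y) div k = torus_dist r s x y" if "x \<in> S" "y \<in> S" for x y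
      unfolding h_def using sub that a b by (intro torus_dist_scale_div) auto
    have "?D (h u) (h w) div k + ?D (h w) (h v) div k \<le> ?D (h u) (h v) div k"
      unfolding eq by (metis div_add1_eq le_add1)
    then have "torus_dist r s u w + torus_dist r s w v \<le> torus_dist r s u v"
      using div uvw by simp
    moreover have "torus_dist r s u v \<le> torus_dist r s u w + torus_dist r s w v"
      using sub uvw by (intro torus_dist_triangle) auto
    ultimately show False
      using S uvw unfolding torus_general_position_def by (meson le_antisym)
  qed
  moreover have "h ` S \<subseteq> {..<r * k + a} \<times> {..<s * k + b}"
    using sub by (auto simp: h_def less)
  ultimately show "torus_general_position (r * k + a) (s * k + b) (h ` S)"
    unfolding torus_general_position_def by blast
qed

section \<open>Configurations of eleven points\<close>

text \<open>
  Without rounding these would be the multiples of \<open>(1, 4 q / 11)\<close>, a cyclic group of order 11 in the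
  torus. For \<open>11 \<le> q \<le> 22\<close> they are in general position: index differences 3 and 5 (modulo 11, up to
  sign) give coordinate distances \<open>(3, q / 11)\<close> and \<open>(5, 2 q / 11)\<close> and hence horizontal pairs, while
  1, 2 and 4 give \<open>(1, 4 q / 11)\<close>, \<open>(2, 3 q / 11)\<close> and \<open>(4, 5 q / 11)\<close> and hence vertical ones. Two
  horizontal steps cover at least 6 and two vertical ones at least \<open>6 q / 11\<close>, which in either case
  is more than half of the cycle. Rounding is exact for \<open>q\<close> equal to 11 or 22; for the other values of
  \<open>q\<close> used below, that it does no damage is a finite check.
\<close>
definition slope4_points :: "nat \<Rightarrow> (nat \<times> nat) list" where
  "slope4_points q = map (\<lambda>i. (i, (4 * q * i div 11) mod q)) [0..<11]"


text \<open>General position in a form that can be evaluated, with lists in place of sets.\<close>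
definition triples_in_general_position :: "nat \<Rightarrow> nat \<Rightarrow> (nat \<times> nat) list \<Rightarrow> bool" where
  "triples_in_general_position m n ps \<longleftrightarrow>
    list_all (\<lambda>u. list_all (\<lambda>v. list_all (\<lambda>w. u \<noteq> v \<and> u \<noteq> w \<and> v \<noteq> w \<longrightarrow>
      torus_dist m n u v \<noteq> torus_dist m n u w + torus_dist m n w v) ps) ps) ps"

lemma triples_in_general_position_slope4_points:
  "triples_in_general_position 11 11 (slope4_points 11)"
  "triples_in_general_position 11 13 (slope4_points 13)"
  "triples_in_general_position 11 15 (slope4_points 15)"
  "triples_in_general_position 11 17 (slope4_points 17)"
  "triples_in_general_position 11 19 (slope4_points 19)"
  "triples_in_general_position 11 21 (slope4_points 21)"
  "triples_in_general_position 11 22 (slope4_points 22)"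
  by code_simp+

lemma torus_general_position_slope4_points:
  assumes "q \<in> {11, 13, 15, 17, 19, 21, 22}"
  shows "torus_general_position 11 q (set (slope4_points q))"
proof -
  have "triples_in_general_position 11 q (slope4_points q)"
    using assms triples_in_general_position_slope4_points by auto
  moreover have "set (slope4_points q) \<subseteq> {..<11} \<times> {..<q}"
    using assms by (auto simp: slope4_points_def)
  ultimately show ?thesis
    unfolding torus_general_position_def triples_in_general_position_def list_all_iff by blast
qed

lemma card_slope4_points: "card (set (slope4_points q)) = 11"
proof -
  have "distinct (slope4_points q)"
    by (auto simp: slope4_points_def distinct_map inj_on_def)
  from distinct_card[OF this] show ?thesis by (simp add: slope4_points_def)
qed

lemma gp_number_cycle_product:
  assumes q: "q \<in> {11, 13, 15, 17, 19, 21, 22}" and "1 \<le> k" and a: "a < k" and b: "b < k"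
  shows "gp_number (cycle_graph (11 * k + a) \<boxtimes> cycle_graph (q * k + b)) = 11"
proof -
  let ?m = "11 * k + a" and ?n = "q * k + b"
  have m: "?m \<ge> 3" using \<open>1 \<le> k\<close> by simp
  have "11 * 1 \<le> q * k" using q \<open>1 \<le> k\<close> by (intro mult_le_mono) auto
  then have n: "?n \<ge> 3" by simp
  note gp_iff = general_position_set_cycle_product[OF m n]
  obtain S where S: "torus_general_position ?m ?n S" "card S = 11"
    using torus_general_position_scale[OF torus_general_position_slope4_points[OF q] a b]
      card_slope4_points by metis
  have "finite {S. torus_general_position ?m ?n S}"
    by (rule finite_subset[of _ "Pow ({..<?m} \<times> {..<?n})"])
       (auto simp: torus_general_position_def)
  moreover have "card T \<le> 11" if "torus_general_position ?m ?n T" for T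
    using card_torus_general_position_le[OF that] m by simp
  ultimately show ?thesis
    unfolding gp_number_def gp_iff by (intro Max_eqI) (use S in \<open>auto intro!: image_eqI[of _ card S]\<close>)
qed

theorem corollary4p13:
  shows "(\<forall>q k a b :: nat. q \<in> {11, 13, 15, 17, 19, 21, 22} \<longrightarrow> 1 \<le> k \<longrightarrow> a < k \<longrightarrow> b < k \<longrightarrow>
            gp_number (cycle_graph (11 * k + a) \<boxtimes> cycle_graph (q * k + b)) = 11) \<and>
         (\<forall>s :: nat. 121 \<le> s \<longrightarrow> gp_number (cycle_graph s \<boxtimes> cycle_graph s) = 11)"
proof (intro conjI allI impI)
  fix q k a b :: nat
  assume "q \<in> {11, 13, 15, 17, 19, 21, 22}" "1 \<le> k" "a < k" "b < k"
  then show "gp_number (cycle_graph (11 * k + a) \<boxtimes> cycle_graph (q * k + b)) = 11"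
    by (rule gp_number_cycle_product)
next
  fix s :: nat
  assume "121 \<le> s"
  \<comment> \<open>With \<open>k = s div 11\<close> and \<open>a = b = s mod 11\<close>, the bound on \<open>s\<close> makes \<open>k \<ge> 11 > a\<close>.\<close>
  then have "11 \<le> s div 11" by simp
  moreover have "s mod 11 < 11" by simp
  ultimately have "1 \<le> s div 11" "s mod 11 < s div 11" by linarith+
  then have "gp_number (cycle_graph (11 * (s div 11) + s mod 11) \<boxtimes>
      cycle_graph (11 * (s div 11) + s mod 11)) = 11"
    by (intro gp_number_cycle_product) auto
  then show "gp_number (cycle_graph s \<boxtimes> cycle_graph s) = 11" by simp
qed

end
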